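(* Let $R$ be a commutative ring with identity and let $L^\partial$ be the dual of the lattice $Id(R)$ of all ideals of $R$ (ordered by inclusion). Then $\mathbb{CG}(R)=G(L^\partial)$, i.e. the comaximal ideal graph of $R$ and the zero-divisor graph of $L^\partial$ have the same vertex set and the same edges.
   Context: The comaximal ideal graph $\mathbb{CG}(R)$ is the simple graph whose vertices are the proper ideals of $R$ not contained in the Jacobson radical $J(R)$, with $I,J$ adjacent iff $I+J=R$. In $L^\partial$ the order is reverse inclusion, so its least element is $R$, its greatest element is $(0)$, and $\inf\{I,J\}=I+J$. For a lattice (or poset) $P$ with least element $0$, $Z(P)=\{a\in P:\exists\, b\in P\setminus\{0\}\text{ such that } 0 \text{ is the only common lower bound of } a \text{ and } b\}$, and the zero-divisor graph $G(P)$ is the simple graph with vertex set $Z(P)\setminus\{0\}$ in which $a,b$ are adjacent iff $0$ is their only common lower bound. *)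

theory Defs
  imports "HOL-Algebra.Algebra" "Graph_Theory.Pair_Digraph"
begin

text \<open>A simple undirected graph, possibly infinite, is represented as a loop-free symmetric pair
  digraph: each undirected edge \<open>{u, v}\<close> is the two arcs \<open>(u, v)\<close> and \<open>(v, u)\<close>.
  Arcs are taken between distinct vertices only.\<close>

definition simple_graph_on :: "'v set \<Rightarrow> ('v \<Rightarrow> 'v \<Rightarrow> bool) \<Rightarrow> 'v pair_pre_digraph"
  where "simple_graph_on V adj =
    \<lparr>pverts = V, parcs = {(u, v). u \<in> V \<and> v \<in> V \<and> u \<noteq> v \<and> adj u v}\<rparr>"

lemma pair_bidirected_digraph_simple_graph_on:
  assumes "\<And>u v. u \<in> V \<Longrightarrow> v \<in> V \<Longrightarrow> adj u v \<Longrightarrow> adj v u"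
  shows "pair_bidirected_digraph (simple_graph_on V adj)"
  by unfold_locales 
    (use assms in \<open>auto simp: simple_graph_on_def symmetric_def arcs_ends_def arc_to_ends_def
      intro!: symI\<close>)

text \<open>Intersecting with the carrier gives the zero ring, which has no maximal ideals, itself as
  Jacobson radical.\<close>

definition jacobson_radical :: "('a, 'm) ring_scheme \<Rightarrow> 'a set"
  where "jacobson_radical R = carrier R \<inter> \<Inter>{M. maximalideal M R}"

definition comaximal_ideal_graph :: "('a, 'm) ring_scheme \<Rightarrow> 'a set pair_pre_digraph"
  where "comaximal_ideal_graph R =
    simple_graph_on {I. ideal I R \<and> I \<noteq> carrier R \<and> \<not> I \<subseteq> jacobson_radical R}
      (\<lambda>I J. I <+>\<^bsub>R\<^esub> J = carrier R)"

definition ideal_lattice :: "('a, 'm) ring_scheme \<Rightarrow> 'a set gorder"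
  where "ideal_lattice R = \<lparr>carrier = {I. ideal I R}, eq = (=), le = (\<subseteq>)\<rparr>"

text \<open>The next three definitions are meant for a partial order \<open>P\<close> that has a least element.\<close>

definition zero_divisor_pair :: "('a, 'm) gorder_scheme \<Rightarrow> 'a \<Rightarrow> 'a \<Rightarrow> bool"
  where "zero_divisor_pair P a b \<longleftrightarrow> Lower P {a, b} = {\<bottom>\<^bsub>P\<^esub>}"

definition poset_zero_divisors :: "('a, 'm) gorder_scheme \<Rightarrow> 'a set"
  where "poset_zero_divisors P =
    {a \<in> carrier P. \<exists>b \<in> carrier P - {\<bottom>\<^bsub>P\<^esub>}. zero_divisor_pair P a b}"

definition zero_divisor_graph :: "('a, 'm) gorder_scheme \<Rightarrow> 'a pair_pre_digraph"
  where "zero_divisor_graph P =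
    simple_graph_on (poset_zero_divisors P - {\<bottom>\<^bsub>P\<^esub>}) (zero_divisor_pair P)"

lemma pair_bidirected_digraph_comaximal_ideal_graph:
  assumes "ring R"
  shows "pair_bidirected_digraph (comaximal_ideal_graph R)"
proof -
  interpret ring R by fact
  have "J <+>\<^bsub>R\<^esub> I = carrier R"
    if "ideal I R" "ideal J R" "I <+>\<^bsub>R\<^esub> J = carrier R" for I J
    using that set_add_comm[of I J] ideal.Icarr by (metis subsetI)
  then show ?thesis
    unfolding comaximal_ideal_graph_def
    by (intro pair_bidirected_digraph_simple_graph_on) auto
qed

lemma pair_bidirected_digraph_zero_divisor_graph:
  "pair_bidirected_digraph (zero_divisor_graph P)"
  unfolding zero_divisor_graph_def zero_divisor_pair_def
  by (intro pair_bidirected_digraph_simple_graph_on) (simp add: insert_commute)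

lemma bottom_inv_ideal_lattice:
  assumes "ring R"
  shows "\<bottom>\<^bsub>inv_gorder (ideal_lattice R)\<^esub> = carrier R"
proof -
  have *: "ideal (carrier R) R" using assms by (rule ring.oneideal)
  have sub: "I \<subseteq> carrier R" if "ideal I R" for I
    using that ideal.Icarr by fastforce
  show ?thesis
    unfolding bottom_def using * sub
    by (intro some_equality) (auto simp: least_def Lower_def ideal_lattice_def)
qed

end

theory Submission
  imports Defs
begin

text \<open>In the order dual of the lattice of ideals, a common lower bound of \<open>I\<close> and \<open>J\<close> is an ideal
  that contains \<open>I + J\<close>, and the least element is \<open>R\<close> itself. Hence two ideals have only the
  trivial common lower bound exactly when they are comaximal, so the adjacency relations of the two
  graphs agree (\<open>zero_divisor_pair_inv_ideal_lattice\<close>). The vertex sets agree because an ideal \<open>I\<close>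
  has a proper comaximal partner exactly when some maximal ideal \<open>M\<close> does not contain \<open>I\<close>, that is,
  when \<open>I\<close> is not contained in the Jacobson radical. Given such an \<open>M\<close>, maximality makes \<open>M\<close> a
  partner of \<open>I\<close>. Conversely, a proper partner lies in a maximal ideal by Krull's theorem, and this
  maximal ideal cannot contain \<open>I\<close> as well (\<open>not_subset_jacobson_radical_iff\<close>).\<close>

text \<open>Krull's theorem, by Zorn's lemma: a union of a nonempty chain of proper ideals is an ideal, and
  it is proper because an ideal is proper if and only if it omits the unit element.\<close>

lemma (in ring) exists_maximalideal_above:
  assumes "ideal I R" "I \<noteq> carrier R"
  obtains M where "maximalideal M R" "I \<subseteq> M"
proof -
  let ?A = "{K. ideal K R \<and> \<one> \<notin> K \<and> I \<subseteq> K}"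
  have "I \<in> ?A"
    using assms ideal.one_imp_carrier by blast
  then have "?A \<noteq> {}"
    by blast
  moreover have "\<Union>C \<in> ?A" if "C \<noteq> {}" "subset.chain ?A C" for C
  proof -
    have "subset.chain {K. ideal K R} C"
      using that by (auto simp: subset_chain_def)
    from chain_Union_is_ideal[OF this] show ?thesis
      using that by (auto simp: subset_chain_def)
  qed
  ultimately have "\<exists>M\<in>?A. \<forall>K\<in>?A. M \<subseteq> K \<longrightarrow> K = M"
    by (rule subset_Zorn_nonempty)
  then obtain M where M: "M \<in> ?A" and max: "\<forall>K\<in>?A. M \<subseteq> K \<longrightarrow> K = M"
    by (rule bexE)
  have "maximalideal M R"
  proof (rule maximalidealI)
    show "ideal M R" "carrier R \<noteq> M"
      using M by auto
    show "K = M \<or> K = carrier R" if "ideal K R" "M \<subseteq> K" for K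
    proof (cases "\<one> \<in> K")
      case True
      then show ?thesis
        using ideal.one_imp_carrier[OF that(1)] by simp
    next
      case False
      then have "K \<in> ?A"
        using that M by auto
      then show ?thesis
        using max that by simp
    qed
  qed
  with M show thesis
    using that[of M] by simp
qed

lemma ideal_subset_carrier:
  assumes "ideal I R"
  shows "I \<subseteq> carrier R"
  using assms by (intro additive_subgroup.a_subset ideal.axioms(1))

lemma (in ring) ideal_sum_subset_iff:
  assumes "ideal I R" "ideal J R" "ideal K R"
  shows "I <+> J \<subseteq> K \<longleftrightarrow> I \<subseteq> K \<and> J \<subseteq> K"
proof -
  have "I \<union> J \<subseteq> carrier R"
    using assms(1,2)[THEN ideal_subset_carrier] by simp
  then have "Idl (I \<union> J) \<subseteq> K \<longleftrightarrow> I \<union> J \<subseteq> K"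
    by (rule Idl_subset_ideal[OF assms(3)])
  then show ?thesis
    using union_genideal[OF assms(1,2)] by simp
qed

text \<open>The zero ring has no maximal ideals, and both sides of the equivalence are then false: its only
  ideal is the carrier.\<close>

lemma (in ring) not_subset_jacobson_radical_iff:
  assumes I: "ideal I R"
  shows "\<not> I \<subseteq> jacobson_radical R \<longleftrightarrow>
    (\<exists>J. ideal J R \<and> J \<noteq> carrier R \<and> I <+> J = carrier R)"
proof
  assume "\<not> I \<subseteq> jacobson_radical R"
  then obtain M where M: "maximalideal M R" "\<not> I \<subseteq> M"
    using ideal_subset_carrier[OF I] unfolding jacobson_radical_def by auto
  interpret M: maximalideal M R by (rule M(1))
  have sum: "ideal (I <+> M) R"
    using I M.is_ideal by (rule add_ideals)
  have "I \<subseteq> I <+> M" "M \<subseteq> I <+> M"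
    using ideal_sum_subset_iff[OF I M.is_ideal sum] by auto
  then have "I <+> M = carrier R"
    using M.I_maximal[OF sum] M(2) ideal_subset_carrier[OF sum] by auto
  then show "\<exists>J. ideal J R \<and> J \<noteq> carrier R \<and> I <+> J = carrier R"
    using M.is_ideal M.I_notcarr by metis
next
  assume "\<exists>J. ideal J R \<and> J \<noteq> carrier R \<and> I <+> J = carrier R"
  then obtain J where J: "ideal J R" "J \<noteq> carrier R" "I <+> J = carrier R"
    by auto
  obtain M where M: "maximalideal M R" "J \<subseteq> M"
    using exists_maximalideal_above[OF J(1,2)] .
  interpret M: maximalideal M R by (rule M(1))
  have "\<not> I \<subseteq> M"
    using ideal_sum_subset_iff[OF I J(1) M.is_ideal] J(3) M(2) M.I_notcarr M.a_subset by auto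
  then show "\<not> I \<subseteq> jacobson_radical R"
    using M(1) unfolding jacobson_radical_def by auto
qed

text \<open>The infimum \<open>I + J\<close> of the dual lattice is itself a common lower bound, so if \<open>R\<close> is the only
  one then \<open>I + J = R\<close>.\<close>

lemma (in ring) zero_divisor_pair_inv_ideal_lattice:
  assumes I: "ideal I R" and J: "ideal J R"
  shows "zero_divisor_pair (inv_gorder (ideal_lattice R)) I J \<longleftrightarrow> I <+> J = carrier R"
proof -
  have sum: "ideal (I <+> J) R"
    using I J by (rule add_ideals)
  have "Lower (inv_gorder (ideal_lattice R)) {I, J} = {K. ideal K R \<and> I \<subseteq> K \<and> J \<subseteq> K}"
    unfolding Lower_def ideal_lattice_def using I J by simp blast
  also have "\<dots> = {K. ideal K R \<and> I <+> J \<subseteq> K}"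
    by (simp add: ideal_sum_subset_iff[OF I J] cong: conj_cong)
  finally have lower: "Lower (inv_gorder (ideal_lattice R)) {I, J} = {K. ideal K R \<and> I <+> J \<subseteq> K}" .
  have "{K. ideal K R \<and> I <+> J \<subseteq> K} = {carrier R} \<longleftrightarrow> I <+> J = carrier R"
  proof
    assume "{K. ideal K R \<and> I <+> J \<subseteq> K} = {carrier R}"
    moreover have "I <+> J \<in> {K. ideal K R \<and> I <+> J \<subseteq> K}"
      using sum by simp
    ultimately show "I <+> J = carrier R"
      by simp
  next
    assume "I <+> J = carrier R"
    then show "{K. ideal K R \<and> I <+> J \<subseteq> K} = {carrier R}"
      using oneideal by (auto dest: ideal_subset_carrier)
  qed
  then show ?thesis
    unfolding zero_divisor_pair_def lower bottom_inv_ideal_lattice[OF ring_axioms] .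
qed

theorem theorem6p2:
  fixes R :: "('a, 'm) ring_scheme"
  assumes "cring R"
  shows "comaximal_ideal_graph R = zero_divisor_graph (inv_gorder (ideal_lattice R))"
proof -
  interpret cring R by fact
  let ?P = "inv_gorder (ideal_lattice R)"
  have bot: "\<bottom>\<^bsub>?P\<^esub> = carrier R"
    by (rule bottom_inv_ideal_lattice) (rule ring_axioms)
  have carr: "carrier ?P = {I. ideal I R}"
    by (simp add: ideal_lattice_def)
  have vertices: "{I. ideal I R \<and> I \<noteq> carrier R \<and> \<not> I \<subseteq> jacobson_radical R}
      = poset_zero_divisors ?P - {\<bottom>\<^bsub>?P\<^esub>}"
    unfolding poset_zero_divisors_def bot carr
    by (rule Set.set_eqI)
      (simp add: not_subset_jacobson_radical_iff zero_divisor_pair_inv_ideal_lattice Bex_def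
        conj_ac cong: conj_cong)
  show ?thesis
    unfolding comaximal_ideal_graph_def zero_divisor_graph_def vertices[symmetric]
      simple_graph_on_def
    by (simp add: zero_divisor_pair_inv_ideal_lattice cong: conj_cong)
qed

end
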